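(* Let $\mathcal{A}\in\mathbb{C}^{n\times n\times n\times n}$ be a conjugate partial-symmetric tensor with $\operatorname{rank}_M(\mathcal{A})=r$, and let $$\mathcal{A}=\sum_{i=1}^r\lambda_i\,E_i\circ\overline{E_i},\qquad \lambda_i\in\mathbb{R},\quad E_i\in S^n,\quad \langle E_i,E_j\rangle=\delta_{ij}.$$ If the $\lambda_i$ are pairwise different, then the SMROA algorithm obtains this decomposition of $\mathcal{A}$ exactly after $r$ iterations; that is, for every output $\{(\hat\lambda_j,\hat X_j)\}_{j=1}^r$ of the algorithm run on $\mathcal{A}$ for $r$ iterations there is a permutation $\pi$ of $\{1,\dots,r\}$ such that for every $j$, $\hat\lambda_j=\lambda_{\pi(j)}$ and $\hat X_j=E_{\pi(j)}$ up to multiplication by a complex number of modulus one.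
   Context: $S^n$ denotes the set of complex symmetric $n\times n$ matrices ($X^T=X$). A tensor $\mathcal{A}\in\mathbb{C}^{n\times n\times n\times n}$ is conjugate partial-symmetric (CPS) if for all $i,j,k,l$: $\mathcal{A}_{ijkl}=\mathcal{A}_{jikl}=\mathcal{A}_{ijlk}$ and $\mathcal{A}_{ijkl}=\overline{\mathcal{A}_{klij}}$. For $X,Y\in\mathbb{C}^{n\times n}$, $(X\circ Y)_{ijkl}=X_{ij}Y_{kl}$; $\overline X$ is the entrywise conjugate; inner products of matrices or tensors are $\langle X,Y\rangle=\sum X\,\overline{Y}$ (sum over all entries), and $\|\cdot\|_F$ is the induced norm. $\operatorname{rank}_M(\mathcal{A})$ is the least $r$ such that $\mathcal{A}=\sum_{i=1}^r\lambda_iE_i\circ\overline{E_i}$ with $\lambda_i\in\mathbb{R}$, $E_i\in S^n$. SMROA (successive matrix outer product rank-one approximation) algorithm: given a CPS tensor $\mathcal{A}$, set $\mathcal{A}_0=\mathcal{A}$. For $j=1,\dots,r$: choose any $$(\hat\lambda_j,\hat X_j)\in\operatorname*{argmin}_{\lambda\in\mathbb{R},\,X\in S^n,\,\|X\|_F=1}\|\mathcal{A}_{j-1}-\lambda\,X\circ\overline{X}\|_F,$$ and set $\mathcal{A}_j=\mathcal{A}_{j-1}-\hat\lambda_j\hat X_j\circ\overline{\hat X_j}$. Output $\{(\hat\lambda_j,\hat X_j)\}_{j=1}^r$. *)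

theory Defs
  imports "HOL-Analysis.Analysis"
begin

type_synonym 'n cmat = "complex ^ 'n ^ 'n"
type_synonym 'n ctensor = "complex ^ 'n ^ 'n ^ 'n ^ 'n"

definition sym_mats :: "'n::finite cmat set" where
  "sym_mats = {X. transpose X = X}"

definition CPS :: "'n::finite ctensor \<Rightarrow> bool" where
  "CPS A \<longleftrightarrow> (\<forall>i j k l.
     A $ i $ j $ k $ l = A $ j $ i $ k $ l \<and>
     A $ i $ j $ k $ l = A $ i $ j $ l $ k \<and>
     A $ i $ j $ k $ l = cnj (A $ k $ l $ i $ j))"

definition mat_outer :: "'n::finite cmat \<Rightarrow> 'n cmat \<Rightarrow> 'n ctensor" (infixl \<open>\<otimes>\<^sub>M\<close> 75) where
  "X \<otimes>\<^sub>M Y = (\<chi> i j k l. X $ i $ j * Y $ k $ l)"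

definition cnj_mat :: "'n::finite cmat \<Rightarrow> 'n cmat" where
  "cnj_mat X = map_matrix cnj X"

definition mat_inner :: "'n::finite cmat \<Rightarrow> 'n cmat \<Rightarrow> complex" where
  "mat_inner X Y = (\<Sum>i\<in>UNIV. \<Sum>j\<in>UNIV. X $ i $ j * cnj (Y $ i $ j))"

definition tensor_inner :: "'n::finite ctensor \<Rightarrow> 'n ctensor \<Rightarrow> complex" where
  "tensor_inner A B = (\<Sum>i\<in>UNIV. \<Sum>j\<in>UNIV. \<Sum>k\<in>UNIV. \<Sum>l\<in>UNIV.
     A $ i $ j $ k $ l * cnj (B $ i $ j $ k $ l))"

text \<open>The library norm on iterated vectors is the Frobenius norm, that is, the norm
  induced by these Hermitian inner products.\<close>

lemma norm_cmat_eq_inner: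
  fixes X :: "'n::finite cmat"
  shows "complex_of_real ((norm X)\<^sup>2) = mat_inner X X"
  by (simp add: mat_inner_def norm_vec_def L2_set_def sum_nonneg
      complex_norm_square [symmetric] del: of_real_power)

lemma norm_ctensor_eq_inner:
  fixes A :: "'n::finite ctensor"
  shows "complex_of_real ((norm A)\<^sup>2) = tensor_inner A A"
  by (simp add: tensor_inner_def norm_vec_def L2_set_def sum_nonneg
      complex_norm_square [symmetric] del: of_real_power)

definition is_mat_decomp ::
    "'n::finite ctensor \<Rightarrow> nat \<Rightarrow> (nat \<Rightarrow> real) \<Rightarrow> (nat \<Rightarrow> 'n cmat) \<Rightarrow> bool" where
  "is_mat_decomp A r lam E \<longleftrightarrow>
     (\<forall>i\<in>{1..r}. E i \<in> sym_mats) \<and>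
     A = (\<Sum>i=1..r. lam i *\<^sub>R (E i \<otimes>\<^sub>M cnj_mat (E i)))"

text \<open>If \<open>A\<close> has no such decomposition (which does not happen for CPS tensors), the value is
  unspecified.\<close>

definition rank_M :: "'n::finite ctensor \<Rightarrow> nat" where
  "rank_M A = (LEAST r. \<exists>lam E. is_mat_decomp A r lam E)"

primrec smroa_residual ::
    "'n::finite ctensor \<Rightarrow> (nat \<Rightarrow> real) \<Rightarrow> (nat \<Rightarrow> 'n cmat) \<Rightarrow> nat \<Rightarrow> 'n ctensor" where
  "smroa_residual A lam X 0 = A"
| "smroa_residual A lam X (Suc j) =
     smroa_residual A lam X j - lam (Suc j) *\<^sub>R (X (Suc j) \<otimes>\<^sub>M cnj_mat (X (Suc j)))"

definition best_rank_one :: "'n::finite ctensor \<Rightarrow> real \<Rightarrow> 'n cmat \<Rightarrow> bool" where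
  "best_rank_one B l X \<longleftrightarrow>
     is_arg_min (\<lambda>(m, Y). norm (B - m *\<^sub>R (Y \<otimes>\<^sub>M cnj_mat Y)))
       (\<lambda>(m, Y). Y \<in> sym_mats \<and> norm Y = 1) (l, X)"

text \<open>\<open>smroa_output A r lam X\<close>: the pairs \<open>(lam j, X j)\<close>, \<open>1 \<le> j \<le> r\<close>, arise as the output of
  some run of \<open>r\<close> iterations on \<open>A\<close>. Each step may pick any minimiser, hence a relation.\<close>

definition smroa_output ::
    "'n::finite ctensor \<Rightarrow> nat \<Rightarrow> (nat \<Rightarrow> real) \<Rightarrow> (nat \<Rightarrow> 'n cmat) \<Rightarrow> bool" where
  "smroa_output A r lam X \<longleftrightarrow>
     (\<forall>j\<in>{1..r}. best_rank_one (smroa_residual A lam X (j - 1)) (lam j) (X j))"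

end

theory Submission
  imports Defs
begin

text \<open>
  Write \<open>Q X\<close> for \<open>X \<otimes>\<^sub>M cnj_mat X\<close>. For the real inner product behind the Frobenius norm,
  \<open>Q X \<bullet> Q Y = \<bar>\<langle>X, Y\<rangle>\<bar>\<^sup>2\<close>. Hence for \<open>B = (\<Sum>i\<in>S. lam i *\<^sub>R Q (E i))\<close> with orthonormal \<open>E i\<close>, and for
  a unit matrix \<open>Y\<close>,
  \<open>\<parallel>B - m *\<^sub>R Q Y\<parallel>\<^sup>2 = \<parallel>B\<parallel>\<^sup>2 - 2 * m * q + m\<^sup>2\<close>, where
  \<open>q = (\<Sum>i\<in>S. lam i * \<bar>\<langle>Y, E i\<rangle>\<bar>\<^sup>2)\<close>.

  A minimiser \<open>(l, X)\<close> therefore has \<open>l = q\<close>, and comparing it with the candidates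
  \<open>(lam i, E i)\<close> gives \<open>\<bar>l\<bar> \<ge> \<bar>lam i\<bar>\<close> for all \<open>i\<close>. By Bessel's inequality the weights
  \<open>\<bar>\<langle>X, E i\<rangle>\<bar>\<^sup>2\<close> have sum at most one, so a weighted sum of the \<open>lam i\<close> can reach \<open>l\<close> only if all the
  weight sits on indices with \<open>lam i = l\<close>. As the \<open>lam i\<close> are distinct, there is exactly one
  such index and its weight is one; the equality case of Bessel then makes \<open>X\<close> a unimodular
  multiple of \<open>E i\<close>. Distinctness is required of the signed values only: a tie
  \<open>lam i = - lam k\<close> does no harm, because mixing the two would lower \<open>\<bar>q\<bar>\<close>.

  This is lemma \<open>best_rank_one_is_component\<close>. Since \<open>Q\<close> does not see unimodular factors, the
  residual is \<open>B\<close> with the \<open>i\<close>-th term removed, which has the same form, so the argument repeats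
  (lemma \<open>smroa_residual_invariant\<close>). The weight argument needs
  \<open>l \<noteq> 0\<close>, which follows from \<open>lam i \<noteq> 0\<close>, and that in turn from the minimality of \<open>r\<close>
  (lemma \<open>rank_M_coeff_nonzero\<close>).
\<close>

section \<open>The Hermitian product and Bessel's identity\<close>

lemma mat_inner_diff_left: "mat_inner (X - Y) Z = mat_inner X Z - mat_inner Y Z"
  by (simp add: mat_inner_def algebra_simps sum_subtractf)

lemma mat_inner_diff_right: "mat_inner X (Y - Z) = mat_inner X Y - mat_inner X Z"
  by (simp add: mat_inner_def algebra_simps sum_subtractf)

lemma mat_inner_sum_left: "mat_inner (\<Sum>i\<in>S. F i) Z = (\<Sum>i\<in>S. mat_inner (F i) Z)"
  by (induction S rule: infinite_finite_induct)
     (simp_all add: mat_inner_def algebra_simps sum.distrib)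

lemma mat_inner_sum_right: "mat_inner Z (\<Sum>i\<in>S. F i) = (\<Sum>i\<in>S. mat_inner Z (F i))"
  by (induction S rule: infinite_finite_induct)
     (simp_all add: mat_inner_def algebra_simps sum.distrib)

lemma mat_inner_scale_left: "mat_inner (map_matrix ((*) c) X) Y = c * mat_inner X Y"
  by (simp add: mat_inner_def map_matrix_def sum_distrib_left algebra_simps)

lemma mat_inner_scale_right: "mat_inner X (map_matrix ((*) c) Y) = cnj c * mat_inner X Y"
  by (simp add: mat_inner_def map_matrix_def sum_distrib_left algebra_simps)

lemma mat_inner_commute: "mat_inner Y X = cnj (mat_inner X Y)"
  by (simp add: mat_inner_def mult.commute)

text \<open>Used twice: the left-hand side is nonnegative, which bounds the total weight by one, and
  where the right-hand side vanishes, \<open>X\<close> equals its projection.\<close>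

lemma bessel_identity:
  assumes "finite S"
    and "\<And>i j. i \<in> S \<Longrightarrow> j \<in> S \<Longrightarrow> mat_inner (E i) (E j) = (if i = j then 1 else 0)"
  shows "(norm (X - (\<Sum>i\<in>S. map_matrix ((*) (mat_inner X (E i))) (E i))))\<^sup>2 =
         (norm X)\<^sup>2 - (\<Sum>i\<in>S. (cmod (mat_inner X (E i)))\<^sup>2)"
proof -
  define P where "P = (\<Sum>i\<in>S. map_matrix ((*) (mat_inner X (E i))) (E i))"
  define N where "N = (\<Sum>i\<in>S. complex_of_real ((cmod (mat_inner X (E i)))\<^sup>2))"
  have XP: "mat_inner X P = N"
    unfolding P_def N_def mat_inner_sum_right mat_inner_scale_right
    by (simp add: complex_norm_square mult.commute del: of_real_power)
  have PX: "mat_inner P X = N"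
    unfolding mat_inner_commute[of P X] XP by (simp add: N_def)
  have PE: "mat_inner P (E k) = mat_inner X (E k)" if "k \<in> S" for k
  proof -
    have "mat_inner P (E k) = (\<Sum>i\<in>S. if i = k then mat_inner X (E i) else 0)"
      unfolding P_def mat_inner_sum_left mat_inner_scale_left
      by (rule sum.cong) (use assms(2) that in auto)
    then show ?thesis
      using assms(1) that by simp
  qed
  have "mat_inner P P = (\<Sum>i\<in>S. cnj (mat_inner X (E i)) * mat_inner P (E i))"
    by (subst (2) P_def) (simp add: mat_inner_sum_right mat_inner_scale_right)
  also have "\<dots> = N"
    unfolding N_def
    by (rule sum.cong)
       (simp_all add: PE complex_norm_square mult.commute del: of_real_power)
  finally have PP: "mat_inner P P = N" .
  have "complex_of_real ((norm (X - P))\<^sup>2) = complex_of_real ((norm X)\<^sup>2) - N"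
    unfolding norm_cmat_eq_inner mat_inner_diff_left mat_inner_diff_right XP PX PP by simp
  also have "\<dots> = complex_of_real ((norm X)\<^sup>2 - (\<Sum>i\<in>S. (cmod (mat_inner X (E i)))\<^sup>2))"
    by (simp add: N_def)
  finally show ?thesis
    unfolding P_def of_real_eq_iff .
qed

section \<open>Rank-one tensors\<close>

text \<open>The fourfold sum factors into \<open>\<langle>X, Y\<rangle>\<close> and its conjugate, so it is already real and
  equals the real inner product, which is its real part.\<close>

lemma inner_mat_outer_cnj:
  "(X \<otimes>\<^sub>M cnj_mat X) \<bullet> (Y \<otimes>\<^sub>M cnj_mat Y) = (cmod (mat_inner X Y))\<^sup>2"
proof -
  have "complex_of_real ((cmod (mat_inner X Y))\<^sup>2) =
      (\<Sum>i\<in>UNIV. \<Sum>j\<in>UNIV. \<Sum>k\<in>UNIV. \<Sum>l\<in>UNIV.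
        (X $ i $ j * cnj (X $ k $ l)) * cnj (Y $ i $ j * cnj (Y $ k $ l)))"
  proof -
    define a where "a i j = X $ i $ j * cnj (Y $ i $ j)" for i j
    have "complex_of_real ((cmod (mat_inner X Y))\<^sup>2) =
        (\<Sum>i\<in>UNIV. \<Sum>j\<in>UNIV. a i j) * (\<Sum>k\<in>UNIV. \<Sum>l\<in>UNIV. cnj (a k l))"
      unfolding complex_norm_square mat_inner_def a_def by simp
    also have "\<dots> = (\<Sum>i\<in>UNIV. \<Sum>j\<in>UNIV. \<Sum>k\<in>UNIV. \<Sum>l\<in>UNIV. a i j * cnj (a k l))"
      unfolding sum_distrib_right unfolding sum_distrib_left ..
    finally show ?thesis
      by (simp add: a_def mult.commute mult.left_commute)
  qed
  then have "(cmod (mat_inner X Y))\<^sup>2 = Re \<dots>"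
    by (metis Re_complex_of_real)
  then show ?thesis
    by (simp add: inner_vec_def mat_outer_def cnj_mat_def map_matrix_def
        inner_complex_def algebra_simps)
qed

lemma norm_mat_outer_cnj: "norm (X \<otimes>\<^sub>M cnj_mat X) = (norm X)\<^sup>2"
proof -
  have "(norm (X \<otimes>\<^sub>M cnj_mat X))\<^sup>2 = ((norm X)\<^sup>2)\<^sup>2"
    unfolding power2_norm_eq_inner[of "X \<otimes>\<^sub>M cnj_mat X"] inner_mat_outer_cnj
      norm_cmat_eq_inner[symmetric] norm_of_real
    by simp
  then show ?thesis
    by (meson norm_ge_zero power2_eq_imp_eq zero_le_power2)
qed

lemma mat_outer_cnj_unimodular:
  assumes "cmod c = 1"
  shows "map_matrix ((*) c) X \<otimes>\<^sub>M cnj_mat (map_matrix ((*) c) X) = X \<otimes>\<^sub>M cnj_mat X"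
proof -
  have "c * cnj c = 1"
    using assms by (simp add: complex_norm_square[symmetric])
  then have "c * x * (cnj c * y) = x * y" for x y
    by (metis mult.assoc mult.commute mult.left_neutral)
  then show ?thesis
    by (simp add: mat_outer_def cnj_mat_def map_matrix_def vec_eq_iff)
qed

section \<open>One step of the algorithm\<close>

text \<open>Every summand of \<open>(\<Sum>i\<in>S. (\<bar>l\<bar> - sgn l * lam i) * t i)\<close> is nonnegative, while the sum
  equals \<open>\<bar>l\<bar> * (sum t S - 1) \<le> 0\<close>; so each summand vanishes. The factor \<open>sgn l\<close> treats
  maximal and minimal weighted sums alike and forces \<open>lam i\<close> to agree with \<open>l\<close> in sign, which
  is why injectivity of \<open>lam\<close> itself, and not of \<open>\<bar>lam\<bar>\<close>, leaves just one index.\<close>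

lemma subconvex_extremal_weight:
  fixes lam t :: "'a \<Rightarrow> real"
  assumes "finite S" "inj_on lam S"
    and "\<And>i. i \<in> S \<Longrightarrow> t i \<ge> 0" "sum t S \<le> 1"
    and l: "l = (\<Sum>i\<in>S. lam i * t i)" "l \<noteq> 0"
    and le: "\<And>i. i \<in> S \<Longrightarrow> \<bar>lam i\<bar> \<le> \<bar>l\<bar>"
  shows "\<exists>i\<in>S. lam i = l \<and> t i = 1"
proof -
  define d where "d i = (\<bar>l\<bar> - sgn l * lam i) * t i" for i
  have d0: "d i \<ge> 0" if "i \<in> S" for i
    using le[OF that] assms(3)[OF that] \<open>l \<noteq> 0\<close>
    by (auto simp: d_def sgn_if intro!: mult_nonneg_nonneg)
  have "sum d S = \<bar>l\<bar> * sum t S - sgn l * l"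
    by (simp add: d_def left_diff_distrib sum_subtractf sum_distrib_left l(1) mult.assoc)
  also have "\<dots> = \<bar>l\<bar> * (sum t S - 1)"
    by (simp add: algebra_simps abs_sgn)
  also have "\<dots> \<le> 0"
    using \<open>sum t S \<le> 1\<close> by (simp add: mult_nonneg_nonpos)
  finally have "sum d S = 0"
    using d0 by (meson antisym sum_nonneg)
  then have "d i = 0" if "i \<in> S" for i
    using d0 that \<open>finite S\<close> by (simp add: sum_nonneg_eq_0_iff)
  then have zero: "t i = 0" if "i \<in> S" "lam i \<noteq> l" for i
    using that \<open>l \<noteq> 0\<close> by (fastforce simp: d_def sgn_if split: if_splits)
  have "\<not> (\<forall>i\<in>S. lam i * t i = 0)"
    using l sum.neutral[of S "\<lambda>i. lam i * t i"] by auto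
  then obtain i where i: "i \<in> S" "lam i = l"
    using zero by auto
  have "lam k * t k = (if k = i then l * t i else 0)" if "k \<in> S" for k
    using zero[OF that] i \<open>inj_on lam S\<close> that by (auto dest: inj_onD)
  then have "l = (\<Sum>k\<in>S. if k = i then l * t i else 0)"
    unfolding l(1) by (intro sum.cong) (simp_all add: l(1)[symmetric])
  then have "t i = 1"
    using i \<open>finite S\<close> \<open>l \<noteq> 0\<close> by simp
  with i show ?thesis
    by blast
qed

text \<open>Completing the square in \<open>m\<close> gives \<open>l = q X\<close>, and then the squared error is
  \<open>\<parallel>B\<parallel>\<^sup>2 - l\<^sup>2\<close>, so no \<open>lam i\<close> exceeds \<open>l\<close> in modulus and \<open>subconvex_extremal_weight\<close> applies.
  The index set \<open>S\<close> is arbitrary because the residuals are supported on subsets of the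
  original indices.\<close>

lemma best_rank_one_is_component:
  fixes E :: "'a \<Rightarrow> 'n::finite cmat"
  assumes "finite S" "S \<noteq> {}" "inj_on lam S"
    and nz: "\<And>i. i \<in> S \<Longrightarrow> lam i \<noteq> 0"
    and sym: "\<And>i. i \<in> S \<Longrightarrow> E i \<in> sym_mats"
    and orth: "\<And>i j. i \<in> S \<Longrightarrow> j \<in> S \<Longrightarrow> mat_inner (E i) (E j) = (if i = j then 1 else 0)"
    and best: "best_rank_one (\<Sum>i\<in>S. lam i *\<^sub>R (E i \<otimes>\<^sub>M cnj_mat (E i))) l X"
  shows "\<exists>i\<in>S. l = lam i \<and> (\<exists>c. cmod c = 1 \<and> X = map_matrix ((*) c) (E i))"
proof -
  define B where "B = (\<Sum>i\<in>S. lam i *\<^sub>R (E i \<otimes>\<^sub>M cnj_mat (E i)))"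
  define q where "q Y = (\<Sum>i\<in>S. lam i * (cmod (mat_inner Y (E i)))\<^sup>2)" for Y
  have X: "X \<in> sym_mats" "norm X = 1"
    using best unfolding best_rank_one_def is_arg_min_def by auto
  have opt: "norm (B - l *\<^sub>R (X \<otimes>\<^sub>M cnj_mat X)) \<le> norm (B - m *\<^sub>R (Y \<otimes>\<^sub>M cnj_mat Y))"
      if "Y \<in> sym_mats" "norm Y = 1" for m Y
    using best that unfolding best_rank_one_def is_arg_min_def B_def[symmetric]
    by (force simp: not_less)
  have expand: "(norm (B - m *\<^sub>R (Y \<otimes>\<^sub>M cnj_mat Y)))\<^sup>2 = (norm B)\<^sup>2 - 2 * m * q Y + m\<^sup>2"
    if "norm Y = 1" for m Y
  proof -
    have "(Y \<otimes>\<^sub>M cnj_mat Y) \<bullet> B = q Y"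
      by (simp add: B_def q_def inner_sum_right inner_mat_outer_cnj)
    moreover have "(Y \<otimes>\<^sub>M cnj_mat Y) \<bullet> (Y \<otimes>\<^sub>M cnj_mat Y) = 1"
      using that by (simp add: power2_norm_eq_inner[symmetric] norm_mat_outer_cnj)
    ultimately show ?thesis
      unfolding power2_norm_eq_inner inner_diff_left inner_diff_right
        inner_scaleR_left inner_scaleR_right inner_commute[of B "Y \<otimes>\<^sub>M cnj_mat Y"]
      by (simp add: power2_eq_square algebra_simps)
  qed
  have opt2: "l\<^sup>2 - 2 * l * q X \<le> m\<^sup>2 - 2 * m * q Y" if "Y \<in> sym_mats" "norm Y = 1" for m Y
    using power_mono[OF opt[OF that], of 2 m] expand[OF X(2), of l] expand[OF that(2), of m]
    by simp
  have "(l - q X)\<^sup>2 \<le> 0"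
    using opt2[OF X, of "q X"] by (simp add: power2_eq_square algebra_simps)
  then have l: "l = q X"
    by simp
  have norm_E: "norm (E i) = 1" if "i \<in> S" for i
    using norm_cmat_eq_inner[of "E i"] orth[OF that that] norm_ge_zero[of "E i"]
    by (simp add: power2_eq_1_iff del: norm_ge_zero flip: of_real_power)
  have q_E: "q (E i) = lam i" if "i \<in> S" for i
  proof -
    have "q (E i) = (\<Sum>k\<in>S. if k = i then lam i else 0)"
      unfolding q_def by (rule sum.cong) (use orth that in auto)
    then show ?thesis
      using that \<open>finite S\<close> by simp
  qed
  have le: "\<bar>lam i\<bar> \<le> \<bar>l\<bar>" if "i \<in> S" for i
    using opt2[OF sym[OF that] norm_E[OF that], of "lam i"] q_E[OF that] l
    by (simp add: abs_le_square_iff power2_eq_square)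
  obtain k where "k \<in> S"
    using \<open>S \<noteq> {}\<close> by blast
  then have "l \<noteq> 0"
    using le nz by fastforce
  have "(\<Sum>i\<in>S. (cmod (mat_inner X (E i)))\<^sup>2) \<le> 1"
    using bessel_identity[OF \<open>finite S\<close> orth, of X] X(2)
      zero_le_power2[of "norm (X - (\<Sum>i\<in>S. map_matrix ((*) (mat_inner X (E i))) (E i)))"]
    by simp
  then obtain i where i: "i \<in> S" "lam i = l" "(cmod (mat_inner X (E i)))\<^sup>2 = 1"
    using subconvex_extremal_weight[OF \<open>finite S\<close> \<open>inj_on lam S\<close>,
        of "\<lambda>i. (cmod (mat_inner X (E i)))\<^sup>2" l] l le \<open>l \<noteq> 0\<close>
    by (auto simp: q_def)
  \<comment> \<open>Equality in Bessel for the one-element system \<open>E i\<close>.\<close>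
  have "X = map_matrix ((*) (mat_inner X (E i))) (E i)"
    using bessel_identity[of "{i}" E X] orth[OF i(1) i(1)] i(3) X(2) by simp
  moreover have "cmod (mat_inner X (E i)) = 1"
    using i(3) norm_ge_zero[of "mat_inner X (E i)"] by (simp add: power2_eq_1_iff del: norm_ge_zero)
  ultimately show ?thesis
    using i by metis
qed

section \<open>Iterating the step\<close>

text \<open>A vanishing coefficient could be dropped, giving a decomposition of length \<open>r - 1\<close>.\<close>

lemma rank_M_coeff_nonzero:
  assumes dec: "is_mat_decomp A r lam E" and rank: "rank_M A = r" and k: "k \<in> {1..r}"
  shows "lam k \<noteq> 0"
proof
  assume "lam k = 0"
  define S where "S = {1..r} - {k}"
  have "card S = r - 1"
    using k by (simp add: S_def)
  then obtain h where h: "bij_betw h {1..r - 1} S"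
    using ex_bij_betw_nat_finite_1[of S] by (auto simp: S_def)
  have "A = (\<Sum>i\<in>S. lam i *\<^sub>R (E i \<otimes>\<^sub>M cnj_mat (E i)))"
    using dec k \<open>lam k = 0\<close> by (simp add: is_mat_decomp_def S_def sum.remove)
  also have "\<dots> = (\<Sum>i=1..r - 1. lam (h i) *\<^sub>R (E (h i) \<otimes>\<^sub>M cnj_mat (E (h i))))"
    by (rule sum.reindex_bij_betw[OF h, symmetric])
  finally have "is_mat_decomp A (r - 1) (lam \<circ> h) (E \<circ> h)"
    using dec bij_betwE[OF h] by (auto simp: is_mat_decomp_def S_def)
  then have "rank_M A \<le> r - 1"
    unfolding rank_M_def by (intro Least_le) blast
  then show False
    using rank k by simp
qed

text \<open>The map \<open>p\<close> records which component was split off in each of the first \<open>j\<close> steps;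
  injectivity holds because a component once removed is absent from all later residuals.\<close>

lemma smroa_residual_invariant:
  fixes E Xhat :: "nat \<Rightarrow> 'n::finite cmat"
  assumes A: "A = (\<Sum>i=1..r. lam i *\<^sub>R (E i \<otimes>\<^sub>M cnj_mat (E i)))"
    and "inj_on lam {1..r}"
    and nz: "\<And>i. i \<in> {1..r} \<Longrightarrow> lam i \<noteq> 0"
    and sym: "\<And>i. i \<in> {1..r} \<Longrightarrow> E i \<in> sym_mats"
    and orth: "\<And>i j. i \<in> {1..r} \<Longrightarrow> j \<in> {1..r} \<Longrightarrow>
      mat_inner (E i) (E j) = (if i = j then 1 else 0)"
    and out: "smroa_output A r lamhat Xhat"
    and "j \<le> r"
  shows "\<exists>p. inj_on p {1..j} \<and> p ` {1..j} \<subseteq> {1..r} \<and>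
    smroa_residual A lamhat Xhat j =
      (\<Sum>i\<in>{1..r} - p ` {1..j}. lam i *\<^sub>R (E i \<otimes>\<^sub>M cnj_mat (E i))) \<and>
    (\<forall>k\<in>{1..j}. lamhat k = lam (p k) \<and>
      (\<exists>c. cmod c = 1 \<and> Xhat k = map_matrix ((*) c) (E (p k))))"
  using \<open>j \<le> r\<close>
proof (induction j)
  case 0
  then show ?case
    by (simp add: A)
next
  case (Suc j)
  then obtain p where inj: "inj_on p {1..j}" and sub: "p ` {1..j} \<subseteq> {1..r}"
    and res: "smroa_residual A lamhat Xhat j =
      (\<Sum>i\<in>{1..r} - p ` {1..j}. lam i *\<^sub>R (E i \<otimes>\<^sub>M cnj_mat (E i)))"
    and match: "\<forall>k\<in>{1..j}. lamhat k = lam (p k) \<and>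
      (\<exists>c. cmod c = 1 \<and> Xhat k = map_matrix ((*) c) (E (p k)))"
    by auto
  define S where "S = {1..r} - p ` {1..j}"
  have "card S = r - j"
    using inj sub by (simp add: S_def card_Diff_subset card_image)
  then have "S \<noteq> {}"
    using Suc.prems by auto
  moreover have "best_rank_one (\<Sum>i\<in>S. lam i *\<^sub>R (E i \<otimes>\<^sub>M cnj_mat (E i)))
      (lamhat (Suc j)) (Xhat (Suc j))"
    using out Suc.prems unfolding S_def res[symmetric] smroa_output_def
    by (metis atLeastAtMost_iff diff_Suc_1 le_add1 plus_1_eq_Suc)
  moreover have "finite S" "inj_on lam S"
    using \<open>inj_on lam {1..r}\<close> by (auto simp: S_def intro: inj_on_subset)
  ultimately have "\<exists>i\<in>S. lamhat (Suc j) = lam i \<and>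
      (\<exists>c. cmod c = 1 \<and> Xhat (Suc j) = map_matrix ((*) c) (E i))"
    using nz sym orth by (intro best_rank_one_is_component) (simp_all add: S_def)
  then obtain i c where i: "i \<in> S" "lamhat (Suc j) = lam i"
    and c: "cmod c = 1" "Xhat (Suc j) = map_matrix ((*) c) (E i)"
    by blast
  define p' where "p' = p(Suc j := i)"
  have p'_old: "p' k = p k" if "k \<in> {1..j}" for k
    using that by (auto simp: p'_def)
  have ins: "{1..Suc j} = insert (Suc j) {1..j}"
    by auto
  have img: "p' ` {1..Suc j} = insert i (p ` {1..j})"
    unfolding ins by (auto simp: p'_def)
  have "inj_on p' {1..Suc j}"
    using inj i(1) unfolding p'_def S_def ins inj_on_insert
    by (auto intro!: inj_on_fun_updI)
  moreover have "p' ` {1..Suc j} \<subseteq> {1..r}"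
    using sub i(1) unfolding img S_def by auto
  moreover have "smroa_residual A lamhat Xhat (Suc j) =
      (\<Sum>i\<in>{1..r} - p' ` {1..Suc j}. lam i *\<^sub>R (E i \<otimes>\<^sub>M cnj_mat (E i)))"
  proof -
    have "{1..r} - p' ` {1..Suc j} = S - {i}"
      unfolding img S_def by auto
    moreover have "smroa_residual A lamhat Xhat (Suc j) =
        (\<Sum>i\<in>S. lam i *\<^sub>R (E i \<otimes>\<^sub>M cnj_mat (E i))) - lam i *\<^sub>R (E i \<otimes>\<^sub>M cnj_mat (E i))"
      by (simp add: res S_def i(2) c mat_outer_cnj_unimodular)
    ultimately show ?thesis
      using \<open>finite S\<close> i(1) by (simp add: sum_diff1)
  qed
  moreover have "\<forall>k\<in>{1..Suc j}. lamhat k = lam (p' k) \<and>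
      (\<exists>c. cmod c = 1 \<and> Xhat k = map_matrix ((*) c) (E (p' k)))"
    unfolding ins using match p'_old i(2) c by (auto simp: p'_def)
  ultimately show ?case
    by blast
qed

theorem theorem7:
  fixes A :: "'n::finite ctensor"
    and r :: nat
    and lam lamhat :: "nat \<Rightarrow> real"
    and E Xhat :: "nat \<Rightarrow> 'n cmat"
  assumes "CPS A"
    and "rank_M A = r"
    and "\<forall>i\<in>{1..r}. E i \<in> sym_mats"
    and "A = (\<Sum>i=1..r. lam i *\<^sub>R (E i \<otimes>\<^sub>M cnj_mat (E i)))"
    and "\<forall>i\<in>{1..r}. \<forall>j\<in>{1..r}. mat_inner (E i) (E j) = (if i = j then 1 else 0)"
    and "\<forall>i\<in>{1..r}. \<forall>j\<in>{1..r}. i \<noteq> j \<longrightarrow> lam i \<noteq> lam j"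
    and "smroa_output A r lamhat Xhat"
  shows "\<exists>\<pi>. \<pi> permutes {1..r} \<and>
           (\<forall>j\<in>{1..r}. lamhat j = lam (\<pi> j) \<and>
             (\<exists>c::complex. cmod c = 1 \<and> Xhat j = map_matrix ((*) c) (E (\<pi> j))))"
proof -
  have "is_mat_decomp A r lam E"
    using assms(3,4) by (simp add: is_mat_decomp_def)
  then have nz: "lam i \<noteq> 0" if "i \<in> {1..r}" for i
    using rank_M_coeff_nonzero[OF _ assms(2) that] by blast
  have "inj_on lam {1..r}"
    using assms(6) by (meson inj_onI)
  then obtain p where inj: "inj_on p {1..r}" and sub: "p ` {1..r} \<subseteq> {1..r}"
    and match: "\<forall>k\<in>{1..r}. lamhat k = lam (p k) \<and>
      (\<exists>c. cmod c = 1 \<and> Xhat k = map_matrix ((*) c) (E (p k)))"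
    using smroa_residual_invariant[OF assms(4) _ nz _ _ assms(7) order_refl] assms(3,5)
    by blast
  define \<pi> where "\<pi> k = (if k \<in> {1..r} then p k else k)" for k
  have "bij_betw p {1..r} {1..r}"
    using inj sub by (simp add: bij_betw_def endo_inj_surj)
  then have "bij_betw \<pi> {1..r} {1..r}"
    by (rule bij_betw_cong[THEN iffD1, rotated]) (simp add: \<pi>_def)
  then have "\<pi> permutes {1..r}"
    by (rule bij_imp_permutes) (auto simp: \<pi>_def)
  then show ?thesis
    using match by (intro exI[of _ \<pi>]) (simp add: \<pi>_def)
qed

end
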